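(* Let $k\in\mathbb{N}$, $k\geq 1$, let $u,v\in H^2(\mathbb{D})$ be nonzero, and let $T=S_k+u\otimes v$ on $H^2(\mathbb{D})$. If $T$ is quasinormal, then $\ker(I-T^*T)$ is a finitely generated $S_k$-invariant subspace of $H^2(\mathbb{D})$; that is, $S_k\ker(I-T^*T)\subseteq\ker(I-T^*T)$ and there is a finite set of functions in $\ker(I-T^*T)$ such that $\ker(I-T^*T)$ is the smallest closed $S_k$-invariant subspace containing it.
   Context: $H^2(\mathbb{D})$ is the Hardy space on the unit disc with orthonormal basis $\{z^n\}_{n\ge 0}$. $S_k$ is the unilateral shift of multiplicity $k$ on $H^2(\mathbb{D})$: $S_k z^n=z^{n+k}$, i.e. multiplication by $z^k$. For nonzero $u,v$, $u\otimes v$ is the rank-one operator $(u\otimes v)f=\langle f,v\rangle u$. An operator $T$ is quasinormal if $T(T^*T)=(T^*T)T$. *)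

theory Defs
  imports "HOL-Complex_Analysis.Complex_Analysis"
begin

section \<open>The Hardy space on the unit disc\<close>

definition taylor_coeff :: "(complex \<Rightarrow> complex) \<Rightarrow> nat \<Rightarrow> complex" where
  "taylor_coeff f n = fps_nth (fps_expansion f 0) n"

lemma holo_has_fps:
  assumes "f holomorphic_on ball 0 1"
  shows "f has_fps_expansion fps_expansion f 0"
  by (rule has_fps_expansion_fps_expansion[of "ball 0 1"]) (use assms in auto)

lemma taylor_coeff_add:
  assumes "f holomorphic_on ball 0 1" "g holomorphic_on ball 0 1"
  shows "taylor_coeff (\<lambda>z. f z + g z) n = taylor_coeff f n + taylor_coeff g n"
  using fps_expansion_eqI[OF has_fps_expansion_add[OF holo_has_fps[OF assms(1)] holo_has_fps[OF assms(2)]]]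
  by (simp add: taylor_coeff_def)

lemma taylor_coeff_cmult:
  assumes "f holomorphic_on ball 0 1"
  shows "taylor_coeff (\<lambda>z. c * f z) n = c * taylor_coeff f n"
  using fps_expansion_eqI[OF has_fps_expansion_cmult_left[OF holo_has_fps[OF assms], of c]]
  by (simp add: taylor_coeff_def)

lemma taylor_coeff_zero: "taylor_coeff (\<lambda>z. 0) n = 0"
  using fps_expansion_eqI[OF has_fps_expansion_0] by (simp add: taylor_coeff_def)

lemma taylor_coeff_power_mult:
  assumes "f holomorphic_on ball 0 1"
  shows "taylor_coeff (\<lambda>z. z ^ k * f z) n = (if n < k then 0 else taylor_coeff f (n - k))"
  using fps_expansion_eqI[OF has_fps_expansion_mult[OF has_fps_expansion_fps_X_power[of k] holo_has_fps[OF assms]]]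
  by (simp add: taylor_coeff_def fps_X_power_mult_nth)

lemma taylor_coeff_eq_0_imp:
  assumes "f holomorphic_on ball 0 1" "\<And>n. taylor_coeff f n = 0" "z \<in> ball 0 1"
  shows "f z = 0"
proof -
  have "(\<lambda>n. (deriv ^^ n) f 0 / fact n * (z - 0) ^ n) sums f z"
    using assms by (intro holomorphic_power_series) auto
  then have "(\<lambda>n. 0) sums f z"
    using assms(2) by (simp add: taylor_coeff_def fps_expansion_def)
  then show ?thesis
    using sums_0 sums_unique2 by blast
qed

text \<open>
  \<open>hardy\<close> is the space of holomorphic functions on the open unit disc with square-summable
  Taylor coefficients at \<open>0\<close>.  As HOL functions are total, elements are normalised to
  vanish outside the disc, so that equality in \<open>hardy\<close> is equality of functions on the disc.
\<close>

typedef hardy = "{f :: complex \<Rightarrow> complex. f holomorphic_on ball 0 1 \<and> (\<forall>z. z \<notin> ball 0 1 \<longrightarrow> f z = 0) \<and>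
    summable (\<lambda>n. (cmod (taylor_coeff f n))\<^sup>2)}"
  morphisms hardy_fun Abs_hardy
  by (rule exI[of _ "\<lambda>z. 0"]) (simp add: taylor_coeff_zero)

setup_lifting type_definition_hardy

lift_definition hcoeff :: "hardy \<Rightarrow> nat \<Rightarrow> complex" is taylor_coeff .

lemma hcoeff_summable: "summable (\<lambda>n. (cmod (hcoeff f n))\<^sup>2)"
  by transfer simp

lemma summable_sq_add:
  fixes a b :: "nat \<Rightarrow> complex"
  assumes "summable (\<lambda>n. (cmod (a n))\<^sup>2)" "summable (\<lambda>n. (cmod (b n))\<^sup>2)"
  shows "summable (\<lambda>n. (cmod (a n + b n))\<^sup>2)"
proof (rule summable_comparison_test')
  show "summable (\<lambda>n. 2 * (cmod (a n))\<^sup>2 + 2 * (cmod (b n))\<^sup>2)"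
    using assms by (intro summable_add summable_mult)
  show "norm ((cmod (a n + b n))\<^sup>2) \<le> 2 * (cmod (a n))\<^sup>2 + 2 * (cmod (b n))\<^sup>2" for n
  proof -
    have "(cmod (a n + b n))\<^sup>2 \<le> (cmod (a n) + cmod (b n))\<^sup>2"
      by (intro power_mono norm_triangle_ineq) auto
    also have "\<dots> \<le> 2 * (cmod (a n))\<^sup>2 + 2 * (cmod (b n))\<^sup>2"
      using sum_squares_bound[of "cmod (a n)" "cmod (b n)"] by (simp add: power2_sum)
    finally show ?thesis by simp
  qed
qed

lemma summable_sq_cmult:
  fixes a :: "nat \<Rightarrow> complex"
  assumes "summable (\<lambda>n. (cmod (a n))\<^sup>2)"
  shows "summable (\<lambda>n. (cmod (c * a n))\<^sup>2)"
  using assms by (simp add: norm_mult power_mult_distrib summable_mult)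

lift_definition hscale :: "complex \<Rightarrow> hardy \<Rightarrow> hardy" is "\<lambda>c f z. c * f z"
  by (auto intro!: holomorphic_intros summable_sq_cmult simp: taylor_coeff_cmult)

instantiation hardy :: real_vector
begin

lift_definition zero_hardy :: hardy is "\<lambda>z. 0"
  by (simp add: taylor_coeff_zero)

lift_definition plus_hardy :: "hardy \<Rightarrow> hardy \<Rightarrow> hardy" is "\<lambda>f g z. f z + g z"
  by (auto intro!: holomorphic_intros summable_sq_add simp: taylor_coeff_add)

definition uminus_hardy :: "hardy \<Rightarrow> hardy" where
  "uminus_hardy f = hscale (- 1) f"

definition minus_hardy :: "hardy \<Rightarrow> hardy \<Rightarrow> hardy" where
  "minus_hardy f g = f + (- g)"

definition scaleR_hardy :: "real \<Rightarrow> hardy \<Rightarrow> hardy" where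
  "scaleR_hardy r f = hscale (complex_of_real r) f"

instance
proof
  fix f g h :: hardy and a b :: real
  show "f + g + h = f + (g + h)"
    by transfer (simp add: add.assoc)
  show "f + g = g + f"
    by transfer (simp add: add.commute)
  show "0 + f = f"
    by transfer simp
  show "- f + f = 0"
    unfolding uminus_hardy_def by transfer simp
  show "f - g = f + - g"
    by (rule minus_hardy_def)
  show "a *\<^sub>R (f + g) = a *\<^sub>R f + a *\<^sub>R g"
    unfolding scaleR_hardy_def by transfer (simp add: distrib_left)
  show "(a + b) *\<^sub>R f = a *\<^sub>R f + b *\<^sub>R f"
    unfolding scaleR_hardy_def by transfer (simp add: distrib_right)
  show "a *\<^sub>R b *\<^sub>R f = (a * b) *\<^sub>R f"
    unfolding scaleR_hardy_def by transfer (simp add: mult.assoc)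
  show "1 *\<^sub>R f = f"
    unfolding scaleR_hardy_def by transfer simp
qed

end

interpretation hardy: vector_space hscale
proof
  fix f g :: hardy and a b :: complex
  show "hscale a (f + g) = hscale a f + hscale a g"
    by transfer (simp add: distrib_left)
  show "hscale (a + b) f = hscale a f + hscale b f"
    by transfer (simp add: distrib_right)
  show "hscale a (hscale b f) = hscale (a * b) f"
    by transfer (simp add: mult.assoc)
  show "hscale 1 f = f"
    by transfer simp
qed

lemma hcoeff_add [simp]: "hcoeff (f + g) n = hcoeff f n + hcoeff g n"
  by transfer (simp add: taylor_coeff_add)

lemma hcoeff_hscale [simp]: "hcoeff (hscale c f) n = c * hcoeff f n"
  by transfer (simp add: taylor_coeff_cmult)

lemma hcoeff_scaleR [simp]: "hcoeff (r *\<^sub>R f) n = of_real r * hcoeff f n"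
  by (simp add: scaleR_hardy_def)

lemma hcoeff_zero [simp]: "hcoeff 0 n = 0"
  by transfer (simp add: taylor_coeff_zero)

lemma hcoeff_eq_0_imp: "(\<And>n. hcoeff f n = 0) \<Longrightarrow> f = 0"
proof (transfer, rule ext)
  fix f :: "complex \<Rightarrow> complex" and z
  assume f: "f holomorphic_on ball 0 1 \<and> (\<forall>z. z \<notin> ball 0 1 \<longrightarrow> f z = 0) \<and>
    summable (\<lambda>n. (cmod (taylor_coeff f n))\<^sup>2)" and "\<And>n. taylor_coeff f n = 0"
  then show "f z = 0"
    using taylor_coeff_eq_0_imp[of f z] by (cases "z \<in> ball 0 1") blast+
qed

subsection \<open>Inner product and norm\<close>

text \<open>The inner product is linear in the first argument.\<close>

definition hinner :: "hardy \<Rightarrow> hardy \<Rightarrow> complex" where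
  "hinner f g = (\<Sum>n. hcoeff f n * cnj (hcoeff g n))"

lemma hinner_summable: "summable (\<lambda>n. hcoeff f n * cnj (hcoeff g n))"
proof (rule summable_comparison_test')
  show "summable (\<lambda>n. (cmod (hcoeff f n))\<^sup>2 + (cmod (hcoeff g n))\<^sup>2)"
    by (intro summable_add hcoeff_summable)
  show "norm (hcoeff f n * cnj (hcoeff g n)) \<le> (cmod (hcoeff f n))\<^sup>2 + (cmod (hcoeff g n))\<^sup>2" for n
  proof -
    have "0 \<le> cmod (hcoeff f n) * cmod (hcoeff g n)"
      by simp
    then show ?thesis
      using sum_squares_bound[of "cmod (hcoeff f n)" "cmod (hcoeff g n)"]
      unfolding norm_mult complex_mod_cnj by linarith
  qed
qed

lemma hinner_add_left: "hinner (f + g) h = hinner f h + hinner g h"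
  unfolding hinner_def by (simp add: distrib_right suminf_add hinner_summable)

lemma hinner_hscale_left: "hinner (hscale c f) g = c * hinner f g"
  unfolding hinner_def by (simp add: mult.assoc suminf_mult hinner_summable)

lemma hinner_commute: "hinner f g = cnj (hinner g f)"
proof -
  have "(\<lambda>n. cnj (hcoeff g n * cnj (hcoeff f n))) sums cnj (hinner g f)"
    unfolding hinner_def sums_cnj by (rule summable_sums[OF hinner_summable])
  then show ?thesis
    unfolding hinner_def[of f g] by (simp add: sums_iff mult.commute)
qed

lemma hinner_self: "hinner f f = of_real (\<Sum>n. (cmod (hcoeff f n))\<^sup>2)"
proof -
  have "(\<lambda>n. hcoeff f n * cnj (hcoeff f n)) = (\<lambda>n. complex_of_real ((cmod (hcoeff f n))\<^sup>2))"
    by (simp only: complex_norm_square)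
  then show ?thesis
    unfolding hinner_def by (simp only: suminf_of_real[OF hcoeff_summable])
qed

text \<open>The real inner product provides the norm and topology; its norm satisfies
  \<open>(norm f)\<^sup>2 = hinner f f\<close>.\<close>

instantiation hardy :: real_inner
begin

definition inner_hardy :: "hardy \<Rightarrow> hardy \<Rightarrow> real" where
  "inner_hardy f g = Re (hinner f g)"

definition norm_hardy :: "hardy \<Rightarrow> real" where
  "norm_hardy f = sqrt (inner f f)"

definition sgn_hardy :: "hardy \<Rightarrow> hardy" where
  "sgn_hardy f = f /\<^sub>R norm f"

definition dist_hardy :: "hardy \<Rightarrow> hardy \<Rightarrow> real" where
  "dist_hardy f g = norm (f - g)"

definition uniformity_hardy :: "(hardy \<times> hardy) filter" where
  "uniformity_hardy = (INF e\<in>{0 <..}. principal {(f, g). dist f g < e})"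

definition open_hardy :: "hardy set \<Rightarrow> bool" where
  "open_hardy U \<longleftrightarrow> (\<forall>f\<in>U. \<forall>\<^sub>F (f', g) in uniformity. f' = f \<longrightarrow> g \<in> U)"

instance
proof
  fix f g h :: hardy and r :: real and U :: "hardy set"
  show "dist f g = norm (f - g)"
    by (rule dist_hardy_def)
  show "sgn f = f /\<^sub>R norm f"
    by (rule sgn_hardy_def)
  show "uniformity = (INF e\<in>{0 <..}. principal {(f :: hardy, g). dist f g < e})"
    by (rule uniformity_hardy_def)
  show "open U \<longleftrightarrow> (\<forall>f\<in>U. \<forall>\<^sub>F (f', g) in uniformity. f' = f \<longrightarrow> g \<in> U)"
    by (rule open_hardy_def)
  show "inner f g = inner g f"
    unfolding inner_hardy_def by (subst hinner_commute) simp
  show "inner (f + g) h = inner f h + inner g h"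
    unfolding inner_hardy_def by (simp add: hinner_add_left)
  show "inner (r *\<^sub>R f) g = r * inner f g"
    unfolding inner_hardy_def scaleR_hardy_def by (simp add: hinner_hscale_left)
  show "0 \<le> inner f f"
    unfolding inner_hardy_def by (simp add: hinner_self suminf_nonneg hcoeff_summable)
  show "inner f f = 0 \<longleftrightarrow> f = 0"
  proof
    assume "inner f f = 0"
    then have "(\<Sum>n. (cmod (hcoeff f n))\<^sup>2) = 0"
      unfolding inner_hardy_def by (simp add: hinner_self)
    then have "\<And>n. hcoeff f n = 0"
      using suminf_eq_zero_iff[OF hcoeff_summable[of f]] by simp
    then show "f = 0"
      by (rule hcoeff_eq_0_imp)
  qed (simp add: inner_hardy_def hinner_def)
  show "norm f = sqrt (inner f f)"
    by (rule norm_hardy_def)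
qed

end

section \<open>Operators\<close>

text \<open>\<open>hshift k\<close> is \<open>S_k\<close>, multiplication by \<open>z ^ k\<close>.\<close>

lift_definition hshift :: "nat \<Rightarrow> hardy \<Rightarrow> hardy" is "\<lambda>k f z. z ^ k * f z"
proof -
  fix k :: nat and f :: "complex \<Rightarrow> complex"
  assume f: "f holomorphic_on ball 0 1 \<and> (\<forall>z. z \<notin> ball 0 1 \<longrightarrow> f z = 0) \<and>
    summable (\<lambda>n. (cmod (taylor_coeff f n))\<^sup>2)"
  have "summable (\<lambda>n. (cmod (taylor_coeff (\<lambda>z. z ^ k * f z) (n + k)))\<^sup>2)"
    using f by (simp add: taylor_coeff_power_mult)
  then have "summable (\<lambda>n. (cmod (taylor_coeff (\<lambda>z. z ^ k * f z) n))\<^sup>2)"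
    by (subst (asm) summable_iff_shift)
  with f show "(\<lambda>z. z ^ k * f z) holomorphic_on ball 0 1 \<and>
      (\<forall>z. z \<notin> ball 0 1 \<longrightarrow> z ^ k * f z = 0) \<and>
      summable (\<lambda>n. (cmod (taylor_coeff (\<lambda>z. z ^ k * f z) n))\<^sup>2)"
    by (auto intro!: holomorphic_intros)
qed

text \<open>The rank-one operator \<open>u \<otimes> v\<close>.\<close>

definition rank_one :: "hardy \<Rightarrow> hardy \<Rightarrow> hardy \<Rightarrow> hardy" where
  "rank_one u v f = hscale (hinner f v) u"

text \<open>
  The Hilbert space adjoint, by analogy with \<^const>\<open>adjoint\<close> but for the complex inner product.
  It is meaningful for bounded linear operators, for which it exists and is unique.
\<close>

definition hadjoint :: "(hardy \<Rightarrow> hardy) \<Rightarrow> hardy \<Rightarrow> hardy" where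
  "hadjoint T = (SOME T'. \<forall>f g. hinner (T f) g = hinner f (T' g))"

definition quasinormal :: "(hardy \<Rightarrow> hardy) \<Rightarrow> bool" where
  "quasinormal T \<longleftrightarrow> T \<circ> (hadjoint T \<circ> T) = (hadjoint T \<circ> T) \<circ> T"

definition hker :: "(hardy \<Rightarrow> hardy) \<Rightarrow> hardy set" where
  "hker A = {f. A f = 0}"

definition closed_invariant_subspace :: "(hardy \<Rightarrow> hardy) \<Rightarrow> hardy set \<Rightarrow> bool" where
  "closed_invariant_subspace A M \<longleftrightarrow> hardy.subspace M \<and> closed M \<and> A ` M \<subseteq> M"

text \<open>\<open>P hull F\<close> is the intersection of all sets containing \<open>F\<close> that satisfy \<open>P\<close>; closed
  invariant subspaces are stable under intersections, so here it is the smallest one.\<close>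

definition finitely_generated_invariant :: "(hardy \<Rightarrow> hardy) \<Rightarrow> hardy set \<Rightarrow> bool" where
  "finitely_generated_invariant A M \<longleftrightarrow> closed_invariant_subspace A M \<and>
     (\<exists>F. finite F \<and> F \<subseteq> M \<and> M = closed_invariant_subspace A hull F)"

section \<open>The monomials form an orthonormal system on which \<open>S_k\<close> acts as a shift\<close>

lift_definition hmonom :: "nat \<Rightarrow> hardy" is "\<lambda>n z. if z \<in> ball 0 1 then z ^ n else 0"
proof -
  fix n :: nat
  let ?f = "\<lambda>z :: complex. if z \<in> ball 0 1 then z ^ n else 0"
  have holo: "?f holomorphic_on ball 0 1"
    by (rule holomorphic_transform[of "\<lambda>z. z ^ n"]) (auto intro!: holomorphic_intros)
  have ev: "eventually (\<lambda>z. z ^ n = ?f z) (nhds 0)"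
    by (rule eventually_nhds_in_open[of "ball 0 1", THEN eventually_mono]) auto
  have "?f has_fps_expansion fps_X ^ n"
    using has_fps_expansion_cong[OF ev refl] has_fps_expansion_fps_X_power by blast
  then have "taylor_coeff ?f m = (if m = n then 1 else 0)" for m
    unfolding taylor_coeff_def by (simp add: fps_expansion_eqI)
  then have "summable (\<lambda>m. (cmod (taylor_coeff ?f m))\<^sup>2)"
    by (intro summable_finite[of "{n}"]) auto
  with holo show "?f holomorphic_on ball 0 1 \<and> (\<forall>z. z \<notin> ball 0 1 \<longrightarrow> ?f z = 0) \<and>
      summable (\<lambda>m. (cmod (taylor_coeff ?f m))\<^sup>2)"
    by simp
qed

lemma hcoeff_hmonom: "hcoeff (hmonom n) m = (if m = n then 1 else 0)"
proof transfer
  fix n m :: nat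
  have ev: "eventually (\<lambda>z :: complex. z ^ n = (if z \<in> ball 0 1 then z ^ n else 0)) (nhds 0)"
    by (rule eventually_nhds_in_open[of "ball 0 1", THEN eventually_mono]) auto
  have "(\<lambda>z :: complex. if z \<in> ball 0 1 then z ^ n else 0) has_fps_expansion fps_X ^ n"
    using has_fps_expansion_cong[OF ev refl] has_fps_expansion_fps_X_power by blast
  then show "taylor_coeff (\<lambda>z. if z \<in> ball 0 1 then z ^ n else 0) m = (if m = n then 1 else 0)"
    unfolding taylor_coeff_def by (simp add: fps_expansion_eqI)
qed

lemma hinner_hmonom_right: "hinner f (hmonom n) = hcoeff f n"
proof -
  have "(\<lambda>m. hcoeff f m * cnj (hcoeff (hmonom n) m)) = (\<lambda>m. if m = n then hcoeff f m else 0)"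
    by (auto simp: hcoeff_hmonom)
  then show ?thesis
    unfolding hinner_def using sums_single[of n "hcoeff f"] by (simp add: sums_iff)
qed

lemma hmonom_orthonormal: "hinner (hmonom m) (hmonom n) = (if m = n then 1 else 0)"
  by (simp add: hinner_hmonom_right hcoeff_hmonom)

lemma hmonom_total: "(\<And>n. hinner f (hmonom n) = 0) \<Longrightarrow> f = 0"
  by (auto simp: hinner_hmonom_right intro: hcoeff_eq_0_imp)

lemma hshift_hmonom: "hshift k (hmonom n) = hmonom (n + k)"
  by transfer (auto simp: power_add)

end

theory Submission
  imports Defs
begin

text \<open>
  Put \<open>w = S\<^sub>k\<^sup>* u\<close>.  Then \<open>T\<^sup>* T - I = w \<otimes> v + v \<otimes> w + \<parallel>u\<parallel>\<^sup>2 v \<otimes> v\<close>, so its kernel \<open>M\<close> is the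
  whole space or the orthogonal complement of \<open>{v}\<close> or of \<open>{v, w}\<close>.  In the last two cases \<open>T\<close>
  and \<open>S\<^sub>k\<close> agree on \<open>M\<close>, and quasinormality makes \<open>M\<close> invariant under \<open>T\<close>.
  If \<open>M = V\<^sup>\<bottom>\<close> with \<open>V\<close> finite is invariant under \<open>S\<^sub>k\<close>, then \<open>S\<^sub>k M\<close> is the orthogonal complement
  of the finite set \<open>{1, \<dots>, z\<^sup>k\<^sup>-\<^sup>1} \<union> S\<^sub>k V\<close>.  Hence \<open>M \<ominus> S\<^sub>k M\<close> is finite-dimensional, and by the
  Wold decomposition it generates \<open>M\<close>.
\<close>

section \<open>Hardy space preliminaries\<close>

lemma hcoeff_diff [simp]: "hcoeff (f - g) n = hcoeff f n - hcoeff g n"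
  using hcoeff_add[of "f - g" g n] by simp

lemma hardy_eqI: "(\<And>n. hcoeff f n = hcoeff g n) \<Longrightarrow> f = g"
  using hcoeff_eq_0_imp[of "f - g"] by simp

lemma hcoeff_hshift [simp]: "hcoeff (hshift k f) n = (if n < k then 0 else hcoeff f (n - k))"
  by transfer (simp add: taylor_coeff_power_mult)

text \<open>A square-summable sequence is bounded, so its power series converges on the disc. This
  is the source of new elements of \<open>hardy\<close>, here the backward shift.\<close>

lemma hcoeff_surj:
  assumes "summable (\<lambda>n. (cmod (a n))\<^sup>2)"
  shows "\<exists>f. hcoeff f = a"
proof -
  define F where "F = Abs_fps a"
  define g where "g = (\<lambda>z. if z \<in> ball 0 1 then eval_fps F z else 0)"
  have "(\<lambda>n. sqrt ((cmod (a n))\<^sup>2)) \<longlonglongrightarrow> sqrt 0"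
    by (intro tendsto_real_sqrt summable_LIMSEQ_zero assms)
  then have "(\<lambda>n. a n) \<longlonglongrightarrow> 0"
    by (simp add: tendsto_norm_zero_iff)
  then have "Bseq a"
    by (simp add: convergent_imp_Bseq convergentI)
  then obtain B where B: "\<And>n. cmod (a n) \<le> B"
    by (auto simp: Bseq_def)
  have radius: "fps_conv_radius F \<ge> 1"
    unfolding fps_conv_radius_def F_def
  proof (rule conv_radius_geI_ex')
    fix r :: real assume r: "0 < r" "ereal r < 1"
    \<comment> \<open>Comparison with the geometric series \<open>B * r ^ n\<close>.\<close>
    show "summable (\<lambda>n. fps_nth (Abs_fps a) n * of_real r ^ n)"
    proof (rule summable_comparison_test')
      show "summable (\<lambda>n. B * r ^ n)"
        using r by (intro summable_mult summable_geometric) (auto simp: one_ereal_def)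
      show "norm (fps_nth (Abs_fps a) n * of_real r ^ n) \<le> B * r ^ n" for n
        using r B[of n] by (simp add: norm_mult norm_power mult_right_mono)
    qed
  qed
  have holo: "g holomorphic_on ball 0 1"
  proof (rule holomorphic_transform)
    show "eval_fps F holomorphic_on ball 0 1"
    proof (intro holomorphic_on_eval_fps subsetI)
      fix z :: complex assume "z \<in> ball 0 1"
      then have "ereal (cmod z) < 1"
        by simp
      with radius show "z \<in> eball 0 (fps_conv_radius F)"
        unfolding in_eball_iff using order_less_le_trans[of "ereal (cmod z)" 1] by simp
    qed
  qed (simp add: g_def)
  have "eventually (\<lambda>z. eval_fps F z = g z) (nhds 0)"
    by (rule eventually_nhds_in_open[of "ball 0 1", THEN eventually_mono]) (auto simp: g_def)
  moreover have "eval_fps F has_fps_expansion F"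
    using radius order_less_le_trans[of "0 :: ereal" 1]
    by (intro eval_fps_has_fps_expansion) simp
  ultimately have "g has_fps_expansion F"
    using has_fps_expansion_cong[OF _ refl] by blast
  then have coeff: "taylor_coeff g = a"
    unfolding taylor_coeff_def by (auto simp: fps_expansion_eqI F_def)
  have "hcoeff (Abs_hardy g) = a"
    using holo coeff assms by (simp add: hcoeff.rep_eq Abs_hardy_inverse g_def)
  then show ?thesis ..
qed

section \<open>Sesquilinearity, the norm and continuity of the complex inner product\<close>

lemma hinner_add_right: "hinner f (g + h) = hinner f g + hinner f h"
  by (simp add: hinner_commute[of f] hinner_add_left)

lemma hinner_hscale_right: "hinner f (hscale c g) = cnj c * hinner f g"
  by (simp add: hinner_commute[of f] hinner_hscale_left)

lemma hinner_diff_left: "hinner (f - g) h = hinner f h - hinner g h"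
  using hinner_add_left[of "f - g" g h] by simp

lemma hinner_diff_right: "hinner f (g - h) = hinner f g - hinner f h"
  using hinner_add_right[of f "g - h" h] by simp

lemma hinner_zero [simp]: "hinner 0 f = 0" "hinner f 0 = 0"
  by (simp_all add: hinner_def)

lemma hinner_self_eq_norm: "hinner f f = of_real ((norm f)\<^sup>2)"
  by (simp add: power2_norm_eq_inner inner_hardy_def hinner_self)

lemma norm_hardy_sq: "(norm f)\<^sup>2 = (\<Sum>n. (cmod (hcoeff f n))\<^sup>2)"
  using hinner_self[of f] by (simp add: hinner_self_eq_norm del: of_real_power)

lemma hinner_self_eq_0_iff [simp]: "hinner f f = 0 \<longleftrightarrow> f = 0"
  by (simp add: hinner_self_eq_norm)

lemma norm_hscale: "norm (hscale c f) = cmod c * norm f"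
proof -
  have "complex_of_real ((norm (hscale c f))\<^sup>2) = c * cnj c * hinner f f"
    by (simp only: hinner_self_eq_norm[symmetric] hinner_hscale_left hinner_hscale_right mult_ac)
  also have "\<dots> = of_real ((cmod c * norm f)\<^sup>2)"
    by (simp only: complex_norm_square[symmetric] hinner_self_eq_norm power_mult_distrib of_real_mult)
  finally have "(norm (hscale c f))\<^sup>2 = (cmod c * norm f)\<^sup>2"
    using of_real_eq_iff by blast
  then show ?thesis
    by (simp add: power2_eq_iff_nonneg)
qed

text \<open>The library inequality only bounds the real part of \<open>hinner f g\<close>. Rotating
  \<open>f\<close> by a scalar \<open>c\<close> of modulus at most 1 makes the inner product real
  and nonnegative.\<close>

lemma hinner_Cauchy_Schwarz: "cmod (hinner f g) \<le> norm f * norm g"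
proof -
  define c where "c = cnj (sgn (hinner f g))"
  have "complex_of_real (cmod (hinner f g)) = c * hinner f g"
    using complex_norm_square[of "hinner f g"]
    by (cases "hinner f g = 0") (simp_all add: c_def sgn_eq field_simps power2_eq_square)
  then have "cmod (hinner f g) = inner (hscale c f) g"
    unfolding inner_hardy_def hinner_hscale_left by (metis Re_complex_of_real)
  also have "\<dots> \<le> norm (hscale c f) * norm g"
    by (rule norm_cauchy_schwarz)
  also have "\<dots> \<le> norm f * norm g"
    by (auto simp: norm_hscale c_def norm_sgn mult_right_mono)
  finally show ?thesis .
qed

lemma closed_hinner_eq_0: "closed {f. hinner f x = 0}"
proof -
  have "bounded_linear (\<lambda>f. hinner f x)"
    by (rule bounded_linear_intro[where K = "norm x"])
      (simp_all add: hinner_add_left scaleR_hardy_def hinner_hscale_left scaleR_conv_of_real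
        hinner_Cauchy_Schwarz)
  then show ?thesis
    by (intro closed_Collect_eq continuous_intros linear_continuous_on)
qed

lemma hshift_add: "hshift k (f + g) = hshift k f + hshift k g"
  by (rule hardy_eqI) simp

lemma hshift_0 [simp]: "hshift 0 f = f"
  by (rule hardy_eqI) simp

lemma hshift_hshift: "hshift j (hshift k f) = hshift (j + k) f"
  by (rule hardy_eqI) auto

section \<open>The adjoint of the shift\<close>

text \<open>This is the backward shift, prescribed through its Taylor coefficients.
  \<open>hcoeff_surj\<close> provides a witness, and \<open>hardy_eqI\<close> makes it
  unique.\<close>

definition hback :: "nat \<Rightarrow> hardy \<Rightarrow> hardy" where
  "hback k f = (SOME g. hcoeff g = (\<lambda>n. hcoeff f (n + k)))"

lemma hcoeff_hback [simp]: "hcoeff (hback k f) n = hcoeff f (n + k)"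
proof -
  have "\<exists>g. hcoeff g = (\<lambda>n. hcoeff f (n + k))"
    by (rule hcoeff_surj) (subst summable_iff_shift, rule hcoeff_summable)
  then have "hcoeff (hback k f) = (\<lambda>n. hcoeff f (n + k))"
    unfolding hback_def by (rule someI_ex)
  then show ?thesis by simp
qed

lemma hback_hshift [simp]: "hback k (hshift k f) = f"
  by (rule hardy_eqI) simp

lemma hshift_hback:
  assumes "\<And>n. n < k \<Longrightarrow> hcoeff f n = 0"
  shows "hshift k (hback k f) = f"
  by (rule hardy_eqI) (simp add: assms)

lemma hinner_hshift_left: "hinner (hshift k f) g = hinner f (hback k g)"
proof -
  have "(\<Sum>n. hcoeff (hshift k f) n * cnj (hcoeff g n)) =
      (\<Sum>n. hcoeff (hshift k f) (n + k) * cnj (hcoeff g (n + k)))"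
    using suminf_split_initial_segment[OF hinner_summable[of "hshift k f" g], of k] by simp
  then show ?thesis
    by (simp add: hinner_def)
qed

lemma hinner_hshift_hshift [simp]: "hinner (hshift k f) (hshift k g) = hinner f g"
  by (simp add: hinner_hshift_left)

lemma norm_hshift [simp]: "norm (hshift k f) = norm f"
  by (simp add: norm_hardy_def inner_hardy_def)

text \<open>The squared norm of \<open>hback k f\<close> is the tail, from index \<open>k\<close>
  on, of the convergent series for the squared norm of \<open>f\<close>.\<close>

lemma norm_hback_tendsto_0: "(\<lambda>k. norm (hback k f)) \<longlonglongrightarrow> 0"
proof -
  let ?a = "\<lambda>n. (cmod (hcoeff f n))\<^sup>2"
  have "(\<lambda>k. suminf ?a - sum ?a {..<k}) \<longlonglongrightarrow> suminf ?a - suminf ?a"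
    by (intro tendsto_diff tendsto_const summable_LIMSEQ hcoeff_summable)
  then have "(\<lambda>k. (norm (hback k f))\<^sup>2) \<longlonglongrightarrow> 0"
    by (simp add: norm_hardy_sq suminf_minus_initial_segment[OF hcoeff_summable])
  then have "(\<lambda>k. sqrt ((norm (hback k f))\<^sup>2)) \<longlonglongrightarrow> sqrt 0"
    by (rule tendsto_real_sqrt)
  then show ?thesis by simp
qed

text \<open>Adjoints are unique: the difference of two candidates at \<open>g\<close> is orthogonal
  to everything, in particular to itself. This replaces the choice in \<open>hadjoint\<close> by an
  explicit formula.\<close>

lemma hadjoint_eqI:
  assumes "\<And>f g. hinner (A f) g = hinner f (B g)"
  shows "hadjoint A = B"
proof
  fix g
  have "\<forall>f g. hinner (A f) g = hinner f (hadjoint A g)"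
    unfolding hadjoint_def by (rule someI[where x = B]) (simp add: assms)
  then have "hinner f (hadjoint A g - B g) = 0" for f
    by (simp add: hinner_diff_right flip: assms)
  then have "hinner (hadjoint A g - B g) (hadjoint A g - B g) = 0"
    by blast
  then show "hadjoint A g = B g"
    by simp
qed

section \<open>Invariant orthogonal complements of finite sets\<close>

definition hperp :: "hardy set \<Rightarrow> hardy set" where
  "hperp V = {f. \<forall>x\<in>V. hinner f x = 0}"

lemma subspace_hperp: "hardy.subspace (hperp V)"
  by (auto simp: hardy.subspace_def hperp_def hinner_add_left hinner_hscale_left)

lemma closed_hperp: "closed (hperp V)"
proof -
  have "hperp V = (\<Inter>x\<in>V. {f. hinner f x = 0})"
    by (auto simp: hperp_def)
  then show ?thesis
    by (simp add: closed_INT closed_hinner_eq_0)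
qed

lemma hperp_span:
  assumes "f \<in> hperp V" "x \<in> hardy.span V"
  shows "hinner f x = 0"
  using assms(2)
proof (induction rule: hardy.span_induct_alt)
  case (step c x y)
  then show ?case
    using assms(1) by (simp add: hperp_def hinner_add_right hinner_hscale_right)
qed simp

text \<open>Orthogonal projection onto a finite span by Gram-Schmidt: each new vector
  \<open>x\<close> is first replaced by its component \<open>x - p\<close> orthogonal to the earlier
  ones.\<close>

lemma hperp_decomposition:
  assumes "finite V"
  shows "\<exists>g \<in> hardy.span V. f - g \<in> hperp V"
  using assms
proof (induction arbitrary: f rule: finite_induct)
  case empty
  then show ?case by (simp add: hperp_def)
next
  case (insert x V)
  obtain g where g: "g \<in> hardy.span V" "f - g \<in> hperp V"
    using insert.IH by blast
  obtain p where p: "p \<in> hardy.span V" "x - p \<in> hperp V"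
    using insert.IH by blast
  define c where "c = hinner (f - g) (x - p) / hinner (x - p) (x - p)"
  define q where "q = g + hscale c (x - p)"
  have span: "hardy.span V \<subseteq> hardy.span (insert x V)"
    by (rule hardy.span_mono) auto
  have "q \<in> hardy.span (insert x V)"
    unfolding q_def using g(1) p(1) span
    by (intro hardy.span_add hardy.span_scale hardy.span_diff) (auto intro: hardy.span_base)
  moreover have "f - q \<in> hperp (insert x V)"
  proof -
    have eq: "f - q = (f - g) - hscale c (x - p)"
      by (simp add: q_def)
    have V: "f - q \<in> hperp V"
      unfolding eq using hardy.subspace_diff[OF subspace_hperp g(2)
        hardy.subspace_scale[OF subspace_hperp p(2)]] .
    have "hinner (f - q) (x - p) = 0"
      unfolding eq hinner_diff_left[of "f - g"] hinner_hscale_left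
      \<comment> \<open>If \<open>x\<close> already lies in the span of \<open>V\<close>, then
        \<open>x - p\<close> may vanish; the claim is then trivial whatever value the division by
        zero gives \<open>c\<close>.\<close>
      by (cases "x - p = 0") (simp_all add: c_def)
    moreover have "hinner (f - q) p = 0"
      using V p(1) by (rule hperp_span)
    ultimately have "hinner (f - q) x = 0"
      by (simp add: hinner_diff_right)
    with V show ?thesis by (simp add: hperp_def)
  qed
  ultimately show ?case by blast
qed

lemma hshift_image_hperp:
  "hshift k ` hperp V = hperp (hmonom ` {..<k} \<union> hshift k ` V)"
proof (intro equalityI subsetI)
  fix f assume "f \<in> hshift k ` hperp V"
  then show "f \<in> hperp (hmonom ` {..<k} \<union> hshift k ` V)"
    by (auto simp: hperp_def hinner_hmonom_right)
next
  fix f assume f: "f \<in> hperp (hmonom ` {..<k} \<union> hshift k ` V)"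
  then have eq: "hshift k (hback k f) = f"
    by (intro hshift_hback) (auto simp: hperp_def simp flip: hinner_hmonom_right)
  have "hinner (hback k f) x = 0" if "x \<in> V" for x
    using f that hinner_hshift_hshift[of k "hback k f" x] by (auto simp: hperp_def eq)
  then have "hback k f \<in> hperp V"
    by (simp add: hperp_def)
  with eq show "f \<in> hshift k ` hperp V"
    by (metis imageI)
qed

section \<open>Wold decomposition and finite generation\<close>

lemma hshift_in_invariant:
  assumes "closed_invariant_subspace (hshift k) N" "f \<in> N"
  shows "hshift (n * k) f \<in> N"
proof (induction n)
  case (Suc n)
  then have "hshift k (hshift (n * k) f) \<in> N"
    using assms(1) by (auto simp: closed_invariant_subspace_def)
  then show ?case by (simp add: hshift_hshift)
qed (use assms in simp)

text \<open>\<open>E\<close> acts as the wandering subspace of \<open>M\<close>. Peeling off its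
  shifts one by one leaves a remainder in the image of \<open>M\<close> under
  \<open>hshift (n * k)\<close>, which tends to 0 because the shift is pure.\<close>

lemma Wold_approximation:
  assumes k: "k \<ge> 1"
    and M: "hardy.subspace M"
    and E: "\<And>f. f \<in> M \<Longrightarrow> \<exists>e\<in>E. \<exists>g\<in>M. f = e + hshift k g"
    and orth: "\<And>e g. e \<in> E \<Longrightarrow> g \<in> M \<Longrightarrow> hinner e (hshift k g) = 0"
    and inv: "hshift k ` M \<subseteq> M"
    and N: "closed_invariant_subspace (hshift k) N" and EN: "E \<subseteq> N"
  shows "M \<subseteq> N"
proof
  fix f assume f: "f \<in> M"
  have N_sub: "hardy.subspace N" and N_closed: "closed N"
    using N by (auto simp: closed_invariant_subspace_def)
  \<comment> \<open>\<open>hshift (n * k) g\<close> is the orthogonal projection of \<open>f\<close> onto \<open>S\<^sub>k\<^sup>n M\<close>, hence bounded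
    by the \<open>n k\<close>-th tail of \<open>f\<close>.\<close>
  have "\<exists>g\<in>M. f - hshift (n * k) g \<in> N \<and>
      (\<forall>m\<in>M. hinner (f - hshift (n * k) g) (hshift (n * k) m) = 0)" for n
  proof (induction n)
    case 0
    show ?case
      using f N_sub by (intro bexI[of _ f]) (auto simp: hardy.subspace_0)
  next
    case (Suc n)
    then obtain g where g: "g \<in> M" "f - hshift (n * k) g \<in> N"
      "\<And>m. m \<in> M \<Longrightarrow> hinner (f - hshift (n * k) g) (hshift (n * k) m) = 0"
      by blast
    obtain e g' where e: "e \<in> E" "g' \<in> M" "g = e + hshift k g'"
      using E[OF g(1)] by blast
    have eq: "f - hshift (Suc n * k) g' = (f - hshift (n * k) g) + hshift (n * k) e"
      by (simp add: e(3) hshift_add hshift_hshift add.commute)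
    have "f - hshift (Suc n * k) g' \<in> N"
      unfolding eq using g(2) e(1) EN N N_sub
      by (intro hardy.subspace_add hshift_in_invariant) auto
    moreover have "hinner (f - hshift (Suc n * k) g') (hshift (Suc n * k) m) = 0"
      if "m \<in> M" for m
    proof -
      have m: "hshift (Suc n * k) m = hshift (n * k) (hshift k m)"
        by (simp add: hshift_hshift add.commute)
      have "hshift k m \<in> M"
        using inv that by blast
      then show ?thesis
        unfolding eq m hinner_add_left hinner_hshift_hshift
        using g(3) orth[OF e(1) that] by simp
    qed
    ultimately show ?case
      using e(2) by blast
  qed
  then obtain g where g: "\<And>n. g n \<in> M" "\<And>n. f - hshift (n * k) (g n) \<in> N"
    "\<And>n m. m \<in> M \<Longrightarrow> hinner (f - hshift (n * k) (g n)) (hshift (n * k) m) = 0"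
    by metis
  have bound: "norm (hshift (n * k) (g n)) \<le> norm (hback (n * k) f)" for n
  proof (cases "g n = 0")
    case False
    \<comment> \<open>The orthogonality relation is tested on \<open>m = g n\<close>. Cauchy-Schwarz
      and division by \<open>norm (g n)\<close> then give the bound.\<close>
    have "hinner (g n) (g n) = hinner f (hshift (n * k) (g n))"
      using g(3)[OF g(1), of n n] by (simp add: hinner_diff_left)
    also have "\<dots> = hinner (hback (n * k) f) (g n)"
      by (simp add: hinner_commute[of f] hinner_commute[of "hback (n * k) f"] hinner_hshift_left)
    finally have "cmod (of_real ((norm (g n))\<^sup>2)) = cmod (hinner (hback (n * k) f) (g n))"
      by (simp only: hinner_self_eq_norm)
    then have "(norm (g n))\<^sup>2 = cmod (hinner (hback (n * k) f) (g n))"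
      by (simp only: norm_of_real abs_of_nonneg zero_le_power2)
    also have "\<dots> \<le> norm (hback (n * k) f) * norm (g n)"
      by (rule hinner_Cauchy_Schwarz)
    finally show ?thesis
      using False by (simp add: power2_eq_square)
  next
    case True
    then have "norm (hshift (n * k) (g n)) = 0" by simp
    then show ?thesis by simp
  qed
  have "filterlim (\<lambda>n. n * k) sequentially sequentially"
    using k by (intro filterlim_subseq) (simp add: strict_mono_def)
  then have "(\<lambda>n. norm (hback (n * k) f)) \<longlonglongrightarrow> 0"
    by (rule filterlim_compose[OF norm_hback_tendsto_0])
  then have "(\<lambda>n. hshift (n * k) (g n)) \<longlonglongrightarrow> 0"
    by (rule Lim_null_comparison[rotated]) (simp add: bound del: norm_hshift)
  then have "(\<lambda>n. f - hshift (n * k) (g n)) \<longlonglongrightarrow> f - 0"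
    by (intro tendsto_diff tendsto_const)
  then show "f \<in> N"
    using closed_sequentially[OF N_closed, of "\<lambda>n. f - hshift (n * k) (g n)" f] g(2) by simp
qed

lemma finitely_generated_hperp:
  assumes k: "k \<ge> 1" and fin: "finite V" and inv: "hshift k ` hperp V \<subseteq> hperp V"
  shows "finitely_generated_invariant (hshift k) (hperp V)"
proof -
  define G where "G = hmonom ` {..<k} \<union> hshift k ` V"
  \<comment> \<open>Since \<open>hperp G\<close> is the shifted space, \<open>E\<close> is its
    orthogonal complement within \<open>hperp V\<close>; intersecting with
    \<open>hardy.span G\<close> makes its finite dimension visible.\<close>
  define E where "E = hperp V \<inter> hardy.span G"
  have finG: "finite G"
    using fin by (simp add: G_def)
  have image: "hshift k ` hperp V = hperp G"
    unfolding G_def by (rule hshift_image_hperp)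
  \<comment> \<open>A basis of \<open>E\<close> serves as the set of generators.\<close>
  obtain F where F: "F \<subseteq> E" "hardy.independent F" "E \<subseteq> hardy.span F"
    by (rule hardy.maximal_independent_subset)
  have "finite F"
    using hardy.independent_span_bound[OF finG F(2)] F(1) by (auto simp: E_def)
  have cis: "closed_invariant_subspace (hshift k) (hperp V)"
    unfolding closed_invariant_subspace_def using subspace_hperp closed_hperp inv by blast
  have decomp: "\<exists>e\<in>E. \<exists>g\<in>hperp V. f = e + hshift k g" if f: "f \<in> hperp V" for f
  proof -
    obtain e where e: "e \<in> hardy.span G" "f - e \<in> hperp G"
      using hperp_decomposition[OF finG] by blast
    then obtain g where g: "g \<in> hperp V" "f - e = hshift k g"
      unfolding image[symmetric] by blast
    have "hshift k g \<in> hperp V"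
      using inv g(1) by blast
    then have "f - hshift k g \<in> hperp V"
      using f subspace_hperp by (intro hardy.subspace_diff)
    moreover have "e = f - hshift k g"
      by (simp flip: g(2))
    ultimately have "e \<in> E"
      using e(1) by (simp add: E_def)
    moreover have "f = e + hshift k g"
      by (simp flip: g(2))
    ultimately show ?thesis
      using g(1) by blast
  qed
  have orth: "hinner e (hshift k g) = 0" if "e \<in> E" "g \<in> hperp V" for e g
  proof -
    have "hinner (hshift k g) e = 0"
      using that image by (intro hperp_span[of _ G]) (auto simp: E_def)
    then show ?thesis
      using hinner_commute[of e "hshift k g"] by simp
  qed
  have "hperp V \<subseteq> N" if N: "closed_invariant_subspace (hshift k) N" "F \<subseteq> N" for N
  proof (rule Wold_approximation[OF k subspace_hperp decomp orth inv N(1)])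
    have "hardy.span F \<subseteq> N"
      using N by (intro hardy.span_minimal) (auto simp: closed_invariant_subspace_def)
    with F(3) show "E \<subseteq> N" by blast
  qed
  then have "hperp V \<subseteq> closed_invariant_subspace (hshift k) hull F"
    by (auto simp: hull_def)
  moreover have "F \<subseteq> hperp V"
    using F(1) by (auto simp: E_def)
  ultimately have "hperp V = closed_invariant_subspace (hshift k) hull F"
    by (auto simp: hull_def cis)
  with cis \<open>finite F\<close> \<open>F \<subseteq> hperp V\<close> show ?thesis
    unfolding finitely_generated_invariant_def by blast
qed

section \<open>Rank-one perturbations of the shift\<close>

theorem theorem1p2:
  fixes k :: nat and u v :: hardy and T :: "hardy \<Rightarrow> hardy"
  assumes "k \<ge> 1" and "u \<noteq> 0" and "v \<noteq> 0"
    and "T = (\<lambda>f. hshift k f + rank_one u v f)"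
    and "quasinormal T"
  shows "finitely_generated_invariant (hshift k) (hker (\<lambda>f. f - hadjoint T (T f)))"
proof -
  define M where "M = hker (\<lambda>f. f - hadjoint T (T f))"
  define w where "w = hback k u"
  have T: "T f = hshift k f + hscale (hinner f v) u" for f
    by (simp add: assms(4) rank_one_def)
  have adj: "hadjoint T = (\<lambda>g. hback k g + hscale (hinner g u) v)"
  proof (rule hadjoint_eqI)
    show "hinner (T f) g = hinner f (hback k g + hscale (hinner g u) v)" for f g
      by (simp add: T hinner_add_left hinner_add_right hinner_hscale_left hinner_hscale_right
          hinner_hshift_left hinner_commute[of u g])
  qed
  have TT: "hadjoint T (T f) = f + (hscale (hinner f v) w +
      hscale (hinner f w + hinner f v * hinner u u) v)" for f
    by (rule hardy_eqI)
      (simp add: adj T w_def hinner_add_left hinner_hscale_left hinner_hshift_left algebra_simps)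
  have M_iff: "f \<in> M \<longleftrightarrow>
      hscale (hinner f v) w + hscale (hinner f w + hinner f v * hinner u u) v = 0" for f
    by (simp only: M_def hker_def TT mem_Collect_eq right_minus_eq add_cancel_left_right[of f]
        add_cancel_right_right[of f])
  \<comment> \<open>\<open>T\<close> commutes with \<open>hadjoint T \<circ> T\<close>, so it
    preserves the eigenspace of that operator for the eigenvalue 1.\<close>
  have T_M: "T f \<in> M" if "f \<in> M" for f
  proof -
    have "hadjoint T (T f) = f"
      using that by (simp add: M_def hker_def)
    moreover have "T (hadjoint T (T f)) = hadjoint T (T (T f))"
      using assms(5) by (simp add: quasinormal_def fun_eq_iff)
    ultimately have "hadjoint T (T (T f)) = T f"
      by simp
    then show ?thesis
      by (simp add: M_def hker_def)
  qed
  \<comment> \<open>Because \<open>v \<in> V\<close>, the rank-one term vanishes on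
    \<open>M\<close>, and invariance passes from \<open>T\<close> to
    \<open>hshift k\<close>.\<close>
  have fg: "finitely_generated_invariant (hshift k) M"
    if "finite V" "v \<in> V" "M = hperp V" for V
  proof -
    have "hshift k f \<in> M" if "f \<in> M" for f
    proof -
      have "hinner f v = 0"
        using that \<open>M = hperp V\<close> \<open>v \<in> V\<close> by (simp add: hperp_def)
      then have "T f = hshift k f"
        by (simp add: T)
      with T_M[OF that] show ?thesis by simp
    qed
    with that show ?thesis
      using finitely_generated_hperp[OF assms(1)] by (metis image_subsetI)
  qed
  show ?thesis
  proof (cases "\<exists>c. w = hscale c v")
    case True
    then obtain c where c: "w = hscale c v" ..
    \<comment> \<open>With \<open>w = hscale c v\<close> the perturbation of the identity collapses
      to \<open>d\<close> times \<open>rank_one v v\<close>; \<open>cnj c\<close> comes from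
      conjugate linearity in the second argument.\<close>
    define d where "d = c + cnj c + hinner u u"
    have iff: "f \<in> M \<longleftrightarrow> hinner f v * d = 0" for f
    proof -
      have "hscale (hinner f v) w + hscale (hinner f w + hinner f v * hinner u u) v =
          hscale (hinner f v * d) v"
        by (rule hardy_eqI) (simp add: c d_def hinner_hscale_right algebra_simps)
      then show ?thesis
        using assms(3) by (simp add: M_iff)
    qed
    show ?thesis
    proof (cases "d = 0")
      case True
      \<comment> \<open>Here \<open>T\<close> is an isometry and \<open>M\<close> is the whole
        space, so invariance under \<open>hshift k\<close> is immediate.\<close>
      then have "M = hperp {}"
        using iff by (auto simp: hperp_def)
      then show ?thesis
        using finitely_generated_hperp[OF assms(1), of "{}"] by (simp add: M_def hperp_def)
    next
      case False
      then have "M = hperp {v}"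
        using iff by (auto simp: hperp_def)
      then show ?thesis
        using fg[of "{v}"] by (simp add: M_def)
    qed
  next
    case False
    \<comment> \<open>As \<open>w\<close> is not a multiple of the nonzero \<open>v\<close>, the two
      are linearly independent and both coefficients in \<open>M_iff\<close> vanish.\<close>
    have "hinner f v = 0 \<and> hinner f w = 0" if "f \<in> M" for f
    proof -
      let ?a = "hinner f v" and ?b = "hinner f w + hinner f v * hinner u u"
      have eq: "hscale ?a w + hscale ?b v = 0"
        using that by (simp add: M_iff)
      have a: "?a = 0"
      proof (rule ccontr)
        assume a: "?a \<noteq> 0"
        have "w = hscale (- ?b / ?a) v"
        proof (rule hardy_eqI)
          fix n
          have "?a * hcoeff w n + ?b * hcoeff v n = 0"
            using arg_cong[OF eq, of "\<lambda>f. hcoeff f n"] by simp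
          then show "hcoeff w n = hcoeff (hscale (- ?b / ?a) v) n"
            using a by (simp add: field_simps add_eq_0_iff)
        qed
        with False show False by blast
      qed
      with eq assms(3) show ?thesis by simp
    qed
    then have "M = hperp {v, w}"
      by (auto simp: hperp_def M_iff)
    then show ?thesis
      using fg[of "{v, w}"] by (simp add: M_def)
  qed
qed

end
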